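(* Let $E_{7,1}$ be the weighted tree with vertices $E_0,E_1,\dots,E_6$, where $E_0$ has weight $3$, all other vertices have weight $2$, and the edges are those of the chain $E_0 - E_1 - E_2 - E_3 - E_4 - E_5$ together with one edge joining $E_6$ and $E_2$. Then the number of elements of the triple root system $R(E_{7,1})$ is $124$.
   Context: For a finite weighted tree $\Gamma$ with vertices $V_i$ of weights $w_i$, the intersection form on $\bigoplus_i\mathbb{Z}V_i$ is the symmetric bilinear form with $(V_i\cdot V_i)=-w_i$ and, for $i\neq j$, $(V_i\cdot V_j)=1$ if $V_i$ and $V_j$ are joined by an edge and $0$ otherwise. A non-zero element $\sum m_iV_i$ is a positive (resp. negative) divisor if all $m_i\ge 0$ (resp. all $m_i\le 0$). The triple root system $R(\Gamma)$ is the set of all positive and negative divisors $Y$ with $(Y\cdot Y)=-2$ or $(Y\cdot Y)=-3$. *)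

theory Defs
  imports "HOL-Library.Poly_Mapping"
begin

record 'a weighted_graph =
  verts :: "'a set"
  edges :: "'a set set"
  weight :: "'a \<Rightarrow> int"

definition adjacent :: "('a, 'b) weighted_graph_scheme \<Rightarrow> 'a \<Rightarrow> 'a \<Rightarrow> bool" where
  "adjacent G u v \<longleftrightarrow> {u, v} \<in> edges G"

definition is_cycle :: "('a, 'b) weighted_graph_scheme \<Rightarrow> 'a list \<Rightarrow> bool" where
  "is_cycle G vs \<longleftrightarrow> 3 \<le> length vs \<and> distinct vs \<and>
     (\<forall>i < length vs. adjacent G (vs ! i) (vs ! (Suc i mod length vs)))"

definition weighted_tree :: "('a, 'b) weighted_graph_scheme \<Rightarrow> bool" where
  "weighted_tree G \<longleftrightarrow>
     finite (verts G) \<and> verts G \<noteq> {} \<and>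
     (\<forall>e \<in> edges G. e \<subseteq> verts G \<and> card e = 2) \<and>
     (\<forall>u \<in> verts G. \<forall>v \<in> verts G. (adjacent G)\<^sup>*\<^sup>* u v) \<and>
     (\<nexists>vs. is_cycle G vs)"

definition pairing :: "('a, 'b) weighted_graph_scheme \<Rightarrow> 'a \<Rightarrow> 'a \<Rightarrow> int" where
  "pairing G u v = (if u = v then - weight G u else if adjacent G u v then 1 else 0)"

text \<open>
  The free abelian group on the vertices consists of the finitely supported functions
  with support contained in the vertex set; the intersection form extends the pairing of
  vertices bilinearly.
\<close>

definition divisor_group :: "('a, 'b) weighted_graph_scheme \<Rightarrow> ('a \<Rightarrow>\<^sub>0 int) set" where
  "divisor_group G = {Y. Poly_Mapping.keys Y \<subseteq> verts G}"

definition intersection_form ::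
    "('a, 'b) weighted_graph_scheme \<Rightarrow> ('a \<Rightarrow>\<^sub>0 int) \<Rightarrow> ('a \<Rightarrow>\<^sub>0 int) \<Rightarrow> int" where
  "intersection_form G Y Z =
     (\<Sum>u \<in> verts G. \<Sum>v \<in> verts G.
        Poly_Mapping.lookup Y u * Poly_Mapping.lookup Z v * pairing G u v)"

definition positive_divisor :: "('a, 'b) weighted_graph_scheme \<Rightarrow> ('a \<Rightarrow>\<^sub>0 int) \<Rightarrow> bool" where
  "positive_divisor G Y \<longleftrightarrow> Y \<in> divisor_group G \<and> Y \<noteq> 0 \<and>
     (\<forall>v \<in> verts G. 0 \<le> Poly_Mapping.lookup Y v)"

definition negative_divisor :: "('a, 'b) weighted_graph_scheme \<Rightarrow> ('a \<Rightarrow>\<^sub>0 int) \<Rightarrow> bool" where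
  "negative_divisor G Y \<longleftrightarrow> Y \<in> divisor_group G \<and> Y \<noteq> 0 \<and>
     (\<forall>v \<in> verts G. Poly_Mapping.lookup Y v \<le> 0)"

definition triple_root_system :: "('a, 'b) weighted_graph_scheme \<Rightarrow> ('a \<Rightarrow>\<^sub>0 int) set" where
  "triple_root_system G =
     {Y. (positive_divisor G Y \<or> negative_divisor G Y) \<and>
         (intersection_form G Y Y = -2 \<or> intersection_form G Y Y = -3)}"

text \<open>The vertex \<open>E\<^sub>i\<close> is represented by the natural number \<open>i\<close>.\<close>

definition E71 :: "nat weighted_graph" where
  "E71 = \<lparr> verts = {0..6},
           edges = {{0, 1}, {1, 2}, {2, 3}, {3, 4}, {4, 5}, {6, 2}},
           weight = (\<lambda>i. if i = 0 then 3 else 2) \<rparr>"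

lemma adjacent_E71_iff:
  "adjacent E71 u v \<longleftrightarrow>
     (u, v) \<in> {(0,1), (1,2), (2,3), (3,4), (4,5), (6,2),
               (1,0), (2,1), (3,2), (4,3), (5,4), (2,6)}"
  by (auto simp: adjacent_def E71_def doubleton_eq_iff)

lemma not_is_cycle_E71: "\<not> is_cycle E71 vs"
proof
  assume c: "is_cycle E71 vs"
  define n where "n = length vs"
  have n: "3 \<le> n" and d: "distinct vs"
    and adj: "\<And>i. i < n \<Longrightarrow> adjacent E71 (vs ! i) (vs ! (Suc i mod n))"
    using c by (auto simp: is_cycle_def n_def)
  have "Max (set vs) \<in> set vs"
    using n by (intro Max_in) (auto simp: n_def)
  then obtain i where i: "i < n" and m: "vs ! i = Max (set vs)"
    by (auto simp: in_set_conv_nth n_def)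
  define j where "j = Suc i mod n"
  define k where "k = (if i = 0 then n - 1 else i - 1)"
  have jk: "j < n" "k < n" "Suc k mod n = i" "j \<noteq> k"
    using n i by (auto simp: j_def k_def mod_Suc)
  have "vs ! j \<le> vs ! i" "vs ! k \<le> vs ! i"
    using jk unfolding m by (auto simp: n_def)
  moreover have "adjacent E71 (vs ! i) (vs ! j)" "adjacent E71 (vs ! k) (vs ! i)"
    using adj[OF i] adj[OF jk(2)] jk by (auto simp: j_def)
  ultimately have "vs ! j = vs ! k"
    unfolding adjacent_E71_iff by auto
  then show False
    using jk d by (simp add: nth_eq_iff_index_eq n_def)
qed

lemma weighted_tree_E71: "weighted_tree E71"
proof -
  have two: "(adjacent E71)\<^sup>*\<^sup>* v 2 \<and> (adjacent E71)\<^sup>*\<^sup>* 2 v" if "v \<in> verts E71" for v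
  proof -
    have s: "(adjacent E71)\<^sup>*\<^sup>* x y" if "adjacent E71 x y" for x y
      using that by (rule r_into_rtranclp)
    have a: "(adjacent E71)\<^sup>*\<^sup>* 0 1" "(adjacent E71)\<^sup>*\<^sup>* 1 2" "(adjacent E71)\<^sup>*\<^sup>* 2 3"
      "(adjacent E71)\<^sup>*\<^sup>* 3 4" "(adjacent E71)\<^sup>*\<^sup>* 4 5" "(adjacent E71)\<^sup>*\<^sup>* 6 2"
      "(adjacent E71)\<^sup>*\<^sup>* 1 0" "(adjacent E71)\<^sup>*\<^sup>* 2 1" "(adjacent E71)\<^sup>*\<^sup>* 3 2"
      "(adjacent E71)\<^sup>*\<^sup>* 4 3" "(adjacent E71)\<^sup>*\<^sup>* 5 4" "(adjacent E71)\<^sup>*\<^sup>* 2 6"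
      by (rule s, simp add: adjacent_E71_iff)+
    have "v \<in> {0, 1, 2, 3, 4, 5, 6}"
      using that by (auto simp: E71_def)
    then show ?thesis
      using a by (auto intro: rtranclp_trans)
  qed
  have "(adjacent E71)\<^sup>*\<^sup>* u v" if "u \<in> verts E71" "v \<in> verts E71" for u v
    using two[OF that(1)] two[OF that(2)] by (meson rtranclp_trans)
  then show ?thesis
    unfolding weighted_tree_def using not_is_cycle_E71 by (auto simp: E71_def)
qed

end

theory Submission
  imports Defs
begin

text \<open>
  Up to sign every element is a positive divisor \<open>\<Sum>a\<^sub>iE\<^sub>i\<close>. The vertices \<open>E\<^sub>1, \<dots>, E\<^sub>6\<close> span a
  lattice of type \<open>D\<^sub>6\<close>; in its standard coordinates, with \<open>E\<^sub>0\<close> projecting to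
  \<open>-(1,1,1,1,1,1)/2\<close>, four times the negative of the self-intersection is \<open>6a\<^sub>0\<^sup>2\<close> plus six
  integer squares. This puts the coefficients of positive divisors of self-intersection \<open>-2\<close>
  or \<open>-3\<close> in a small region, which is searched exhaustively.
\<close>

definition positive_roots :: "('a, 'b) weighted_graph_scheme \<Rightarrow> ('a \<Rightarrow>\<^sub>0 int) set" where
  "positive_roots G =
     {Y. positive_divisor G Y \<and> (intersection_form G Y Y = -2 \<or> intersection_form G Y Y = -3)}"

lemma intersection_form_uminus: "intersection_form G (- Y) (- Y) = intersection_form G Y Y"
  by (simp add: intersection_form_def)

lemma negative_divisor_iff: "negative_divisor G Y \<longleftrightarrow> positive_divisor G (- Y)"
  by (simp add: negative_divisor_def positive_divisor_def divisor_group_def)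

lemma positive_divisor_not_uminus:
  assumes "positive_divisor G Y"
  shows "\<not> positive_divisor G (- Y)"
proof
  assume "positive_divisor G (- Y)"
  with assms have "Poly_Mapping.lookup Y v = 0" if "v \<in> verts G" for v
    using that by (force simp: positive_divisor_def)
  then have "Y = 0"
    using assms
    by (intro poly_mapping_eqI) (auto simp: positive_divisor_def divisor_group_def in_keys_iff)
  then show False
    using assms by (simp add: positive_divisor_def)
qed

text \<open>Negation preserves the form and exchanges positive and negative divisors, and no divisor
  is both, because zero is excluded.\<close>

lemma card_triple_root_system:
  assumes "finite (positive_roots G)"
  shows "card (triple_root_system G) = 2 * card (positive_roots G)"
proof -
  have "triple_root_system G = positive_roots G \<union> uminus ` positive_roots G"
  proof (intro set_eqI iffI)
    fix Y
    assume "Y \<in> triple_root_system G"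
    then have "Y \<in> positive_roots G \<or> - Y \<in> positive_roots G"
      by (auto simp: triple_root_system_def positive_roots_def negative_divisor_iff
          intersection_form_uminus)
    then show "Y \<in> positive_roots G \<union> uminus ` positive_roots G"
      by (metis UnI1 UnI2 imageI minus_minus)
  qed (auto simp: triple_root_system_def positive_roots_def negative_divisor_iff
      intersection_form_uminus)
  moreover have "positive_roots G \<inter> uminus ` positive_roots G = {}"
    using positive_divisor_not_uminus by (auto simp: positive_roots_def)
  moreover have "card (uminus ` positive_roots G) = card (positive_roots G)"
    by (intro card_image) simp
  ultimately show ?thesis
    using assms by (simp add: card_Un_disjoint)
qed

text \<open>The intersection form with its sign reversed, hence positive definite. The last variable
  \<open>g\<close> belongs to the branch attached at \<open>c\<close>.\<close>

definition form_E71 :: "int \<times> int \<times> int \<times> int \<times> int \<times> int \<times> int \<Rightarrow> int" where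
  "form_E71 = (\<lambda>(a, b, c, d, e, f, g).
     3*a*a + 2*(b*b + c*c + d*d + e*e + f*f + g*g - a*b - b*c - c*d - d*e - e*f - c*g))"

definition coeffs_E71 :: "(nat \<Rightarrow>\<^sub>0 int) \<Rightarrow> int \<times> int \<times> int \<times> int \<times> int \<times> int \<times> int" where
  "coeffs_E71 Y =
     (Poly_Mapping.lookup Y 0, Poly_Mapping.lookup Y 1, Poly_Mapping.lookup Y 2,
      Poly_Mapping.lookup Y 3, Poly_Mapping.lookup Y 4, Poly_Mapping.lookup Y 5,
      Poly_Mapping.lookup Y 6)"

definition divisor_E71 :: "int \<times> int \<times> int \<times> int \<times> int \<times> int \<times> int \<Rightarrow> (nat \<Rightarrow>\<^sub>0 int)" where
  "divisor_E71 = (\<lambda>(a, b, c, d, e, f, g).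
     Poly_Mapping.single 0 a + Poly_Mapping.single 1 b + Poly_Mapping.single 2 c +
     Poly_Mapping.single 3 d + Poly_Mapping.single 4 e + Poly_Mapping.single 5 f +
     Poly_Mapping.single 6 g)"

lemma verts_E71: "verts E71 = {0, 1, 2, 3, 4, 5, 6}"
  by (auto simp: E71_def)

lemma intersection_form_E71: "intersection_form E71 Y Y = - form_E71 (coeffs_E71 Y)"
proof -
  have w: "weight E71 v = (if v = 0 then 3 else 2)" for v
    by (simp add: E71_def)
  show ?thesis
    by (simp add: intersection_form_def verts_E71 pairing_def adjacent_E71_iff w
        form_E71_def coeffs_E71_def algebra_simps)
qed

lemma coeffs_divisor_E71: "coeffs_E71 (divisor_E71 t) = t"
  by (cases t) (simp add: coeffs_E71_def divisor_E71_def lookup_add lookup_single)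

lemma divisor_E71_in_divisor_group: "divisor_E71 t \<in> divisor_group E71"
  by (cases t) (auto simp: divisor_group_def divisor_E71_def verts_E71 in_keys_iff lookup_add
      lookup_single when_def split: if_splits)

lemma divisor_coeffs_E71:
  assumes "Y \<in> divisor_group E71"
  shows "divisor_E71 (coeffs_E71 Y) = Y"
proof (rule poly_mapping_eqI)
  fix v
  show "Poly_Mapping.lookup (divisor_E71 (coeffs_E71 Y)) v = Poly_Mapping.lookup Y v"
  proof (cases "v \<in> verts E71")
    case True
    then show ?thesis
      by (auto simp: verts_E71 coeffs_E71_def divisor_E71_def lookup_add lookup_single)
  next
    case False
    then have "v \<notin> Poly_Mapping.keys Y"
      using assms by (auto simp: divisor_group_def)
    with False show ?thesis
      by (auto simp: verts_E71 coeffs_E71_def divisor_E71_def lookup_add lookup_single in_keys_iff)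
  qed
qed

text \<open>The zero tuple is ruled out by the values 2 and 3, since the form vanishes
  there.\<close>

definition root_coeffs :: "(int \<times> int \<times> int \<times> int \<times> int \<times> int \<times> int) set" where
  "root_coeffs = {(a, b, c, d, e, f, g).
     0 \<le> a \<and> 0 \<le> b \<and> 0 \<le> c \<and> 0 \<le> d \<and> 0 \<le> e \<and> 0 \<le> f \<and> 0 \<le> g \<and>
     form_E71 (a, b, c, d, e, f, g) \<in> {2, 3}}"

lemma positive_divisor_E71_iff:
  "positive_divisor E71 (divisor_E71 (a, b, c, d, e, f, g)) \<longleftrightarrow>
     0 \<le> a \<and> 0 \<le> b \<and> 0 \<le> c \<and> 0 \<le> d \<and> 0 \<le> e \<and> 0 \<le> f \<and> 0 \<le> g \<and>
     (a, b, c, d, e, f, g) \<noteq> (0, 0, 0, 0, 0, 0, 0)"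
proof -
  have "divisor_E71 (0, 0, 0, 0, 0, 0, 0) = 0"
    by (simp add: divisor_E71_def)
  then have "divisor_E71 (a, b, c, d, e, f, g) = 0 \<longleftrightarrow> (a, b, c, d, e, f, g) = (0, 0, 0, 0, 0, 0, 0)"
    by (metis coeffs_divisor_E71)
  moreover have "(\<forall>v \<in> verts E71. 0 \<le> Poly_Mapping.lookup (divisor_E71 (a, b, c, d, e, f, g)) v) \<longleftrightarrow>
      0 \<le> a \<and> 0 \<le> b \<and> 0 \<le> c \<and> 0 \<le> d \<and> 0 \<le> e \<and> 0 \<le> f \<and> 0 \<le> g"
    by (simp add: verts_E71 divisor_E71_def lookup_add lookup_single)
  ultimately show ?thesis
    by (simp add: positive_divisor_def divisor_E71_in_divisor_group conj_ac)
qed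

lemma positive_roots_E71: "positive_roots E71 = divisor_E71 ` root_coeffs"
proof -
  have "divisor_E71 t \<in> positive_roots E71 \<longleftrightarrow> t \<in> root_coeffs" for t
    by (cases t) (auto simp: positive_roots_def root_coeffs_def positive_divisor_E71_iff
        intersection_form_E71 coeffs_divisor_E71 form_E71_def)
  moreover have "Y \<in> range divisor_E71" if "Y \<in> positive_roots E71" for Y
    using that divisor_coeffs_E71[of Y]
    by (metis (no_types, lifting) mem_Collect_eq positive_divisor_def positive_roots_def rangeI)
  ultimately show ?thesis
    by blast
qed

lemma card_positive_roots_E71: "card (positive_roots E71) = card root_coeffs"
  unfolding positive_roots_E71
  by (intro card_image inj_on_inverseI[of _ coeffs_E71] coeffs_divisor_E71)

text \<open>With e_1, ..., e_6 the standard basis, \<open>E_5\<close>, \<open>E_4\<close>,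
  \<open>E_3\<close>, \<open>E_2\<close> are e_1 - e_2, ..., e_4 - e_5, while \<open>E_1\<close> is
  e_5 + e_6 and \<open>E_6\<close> is e_5 - e_6. The part of \<open>E_0\<close> orthogonal to this
  lattice has squared length 3 - 6/4 = 3/2, whence the coefficient 6.\<close>

lemma form_E71_sum_of_squares:
  "4 * form_E71 (a, b, c, d, e, f, g) =
     6*a\<^sup>2 + (2*f - a)\<^sup>2 + (2*(e - f) - a)\<^sup>2 + (2*(d - e) - a)\<^sup>2 + (2*(c - d) - a)\<^sup>2 +
     (2*(b + g - c) - a)\<^sup>2 + (2*(b - g) - a)\<^sup>2"
  by (simp add: form_E71_def power2_eq_square algebra_simps)

text \<open>The ranges express \<open>a - 1 \<le> x \<le> 1\<close> for the \<open>x\<close> of the squares \<open>(2x - a)\<^sup>2\<close> above.\<close>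

definition root_list :: "(int \<times> int \<times> int \<times> int \<times> int \<times> int \<times> int) list" where
  "root_list = filter (\<lambda>t. form_E71 t = 2 \<or> form_E71 t = 3)
     [(a, b, c, d, e, f, g). a \<leftarrow> [0..1], f \<leftarrow> [0..1],
        e \<leftarrow> [max 0 (f+a-1)..f+1], d \<leftarrow> [max 0 (e+a-1)..e+1], c \<leftarrow> [max 0 (d+a-1)..d+1],
        b \<leftarrow> [0..3], g \<leftarrow> [max 0 (b-1)..b-a+1]]"

lemma abs_le_if_square_less:
  fixes x n :: int
  assumes "x\<^sup>2 < (n + 1)\<^sup>2" "0 \<le> n"
  shows "\<bar>x\<bar> \<le> n"
  using power2_less_imp_less[of "\<bar>x\<bar>" "n + 1"] assms by simp

lemma root_coeffs_eq: "root_coeffs = set root_list"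
proof (intro set_eqI iffI)
  fix t
  assume t: "t \<in> root_coeffs"
  obtain a b c d e f g where abc: "t = (a, b, c, d, e, f, g)"
    by (cases t)
  have nonneg: "0 \<le> a" "0 \<le> b" "0 \<le> c" "0 \<le> d" "0 \<le> e" "0 \<le> f" "0 \<le> g"
    and form: "form_E71 t = 2 \<or> form_E71 t = 3"
    using t by (auto simp: root_coeffs_def abc)
  note sq = form_E71_sum_of_squares[of a b c d e f g, folded abc]
  have nn: "0 \<le> (2*f - a)\<^sup>2" "0 \<le> (2*(e - f) - a)\<^sup>2" "0 \<le> (2*(d - e) - a)\<^sup>2"
    "0 \<le> (2*(c - d) - a)\<^sup>2" "0 \<le> (2*(b + g - c) - a)\<^sup>2" "0 \<le> (2*(b - g) - a)\<^sup>2"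
    by simp_all
  \<comment> \<open>The form is at most 3, so the whole sum of squares is at most 12.\<close>
  have "6 * a\<^sup>2 \<le> 12"
    using form sq nn by linarith
  then have "a \<le> 1"
    using abs_le_if_square_less[of a 1] by simp
  then have a: "a = 0 \<or> a = 1"
    using nonneg by linarith
  \<comment> \<open>For \<open>a = 0\<close> the square is at most 12 < 16, for \<open>a = 1\<close>
    at most 6 < 9; hence \<open>3 - a\<close> bounds the absolute value of \<open>2*x - a\<close>,
    and integrality of \<open>x\<close> gives the range.\<close>
  have bound: "x \<le> 1 \<and> a - 1 \<le> x" if "6 * a\<^sup>2 + (2*x - a)\<^sup>2 \<le> 12" for x
    using a that abs_le_if_square_less[of "2*x - a" "3 - a"] by auto
  have "f \<le> 1 \<and> a - 1 \<le> f"
    by (rule bound) (use form sq nn in linarith)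
  moreover have "e - f \<le> 1 \<and> a - 1 \<le> e - f"
    by (rule bound) (use form sq nn in linarith)
  moreover have "d - e \<le> 1 \<and> a - 1 \<le> d - e"
    by (rule bound) (use form sq nn in linarith)
  moreover have "c - d \<le> 1 \<and> a - 1 \<le> c - d"
    by (rule bound) (use form sq nn in linarith)
  moreover have "b + g - c \<le> 1 \<and> a - 1 \<le> b + g - c"
    by (rule bound) (use form sq nn in linarith)
  moreover have "b - g \<le> 1 \<and> a - 1 \<le> b - g"
    by (rule bound) (use form sq nn in linarith)
  \<comment> \<open>The bound on \<open>b\<close> adds up the two coordinates containing it: 2b
    \<le> c + 2, and c \<le> f + 3 \<le> 4 along the chain.\<close>
  ultimately have "f \<le> 1" "f + a - 1 \<le> e" "e \<le> f + 1" "e + a - 1 \<le> d" "d \<le> e + 1"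
    "d + a - 1 \<le> c" "c \<le> d + 1" "b \<le> 3" "b - 1 \<le> g" "g \<le> b - a + 1"
    by linarith+
  with nonneg \<open>a \<le> 1\<close> form show "t \<in> set root_list"
    unfolding root_list_def abc
    by (simp only: set_filter set_concat set_map set_upto UN_iff image_iff bex_simps)
      (auto simp: Bex_def)
\<comment> \<open>Conversely, every range starts at 0 or at a maximum with 0, so listed tuples are
  nonnegative.\<close>
qed (auto simp: root_coeffs_def root_list_def)

lemma distinct_root_list: "distinct root_list"
  by code_simp

text \<open>The count splits as 30 + 32: for \<open>a = 0\<close> the positive roots of
  \<open>D_6\<close>, for \<open>a = 1\<close> the weights of a half-spin representation, where all
  six squares equal 1 and the form is 3.\<close>

lemma length_root_list: "length root_list = 62"
  by code_simp

theorem proposition3p26: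
  shows "card (triple_root_system E71) = 124"
proof -
  have "card root_coeffs = 62"
    by (simp add: root_coeffs_eq distinct_card distinct_root_list length_root_list)
  moreover have "finite (positive_roots E71)"
    by (simp add: positive_roots_E71 root_coeffs_eq)
  ultimately show ?thesis
    by (simp add: card_triple_root_system card_positive_roots_E71)
qed

end
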